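(* Let $f:\mathbb{R}^n\to\mathbb{R}$ be a closed proper $\mu$-strongly convex function ($\mu>0$), $T:\mathbb{R}^n\to\mathbb{R}^m$ a linear map, $b\in\mathbb{R}^m$, and $\mathcal{K}\subseteq\mathbb{R}^m$ a regular closed convex cone. Suppose $e\in\operatorname{int}\mathcal{K}$ and $c_D>0$ are such that the dual problem $$(\mathrm{D})\quad\min_{y\in\mathbb{R}^m}\ h(y):=(f^*\circ T^* )(y)+\langle b,y\rangle\quad\text{s.t. } y\in\mathcal{K}^*$$ has at least one optimal solution $y_{\mathrm{opt}}$ with $\langle e,y_{\mathrm{opt}}\rangle\le c_D$, and let $d^*$ be its optimal value. Let $\{(x_k,y_k)\}\subseteq\mathbb{R}^n\times\mathbb{R}^m$ be a sequence such that, for every $k$, $y_k\in\mathcal{K}^*$, $\langle e,y_k\rangle\le c_D$ and $x_k=\nabla f^*(T^*y_k)$, and such that $h(y_k)\to d^*$. Then $$\lim_{k\to\infty}x_k=x_{\mathrm{opt}},$$ where $x_{\mathrm{opt}}$ is the (unique) optimal solution of $\min_{x\in\mathbb{R}^n}\{f(x)\mid Tx+b\in\mathcal{K}\}$.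
   Context: $\mathbb{R}^n$ and $\mathbb{R}^m$ carry arbitrary inner products $\langle\cdot,\cdot\rangle$ with induced norms $\|\cdot\|$; the adjoint $T^*$, conjugates, gradients and dual cones are taken with respect to them. A closed convex cone is regular if it is pointed ($\mathcal{K}\cap-\mathcal{K}=\{0\}$) and has nonempty interior. $\mathcal{K}^*=\{y\mid\langle x,y\rangle\ge 0\ \forall x\in\mathcal{K}\}$. $f$ is $\mu$-strongly convex if $f(\theta x+(1-\theta)y)\le\theta f(x)+(1-\theta)f(y)-\frac{\mu}{2}\theta(1-\theta)\|x-y\|^2$ for all $x,y$ and $\theta\in[0,1]$. $f^*(s)=\sup_x\{\langle s,x\rangle-f(x)\}$ is the conjugate of $f$; it is finite and differentiable on $\mathbb{R}^n$ here. *)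

theory Defs
  imports "HOL-Analysis.Analysis"
begin

text \<open>
  \<open>\<real>\<^sup>n\<close> and \<open>\<real>\<^sup>m\<close> with arbitrary inner products are rendered by type variables of class
  \<open>euclidean_space\<close>, i.e. arbitrary finite-dimensional real inner product spaces. Norm, adjoint,
  gradient (\<open>GDERIV\<close>), conjugate and dual cone all refer to the inner product \<open>\<bullet>\<close> of the type.
\<close>

definition strongly_convex :: "real \<Rightarrow> ('a::real_inner \<Rightarrow> real) \<Rightarrow> bool" where
  "strongly_convex \<mu> f \<longleftrightarrow>
     (\<forall>x y. \<forall>\<theta>\<in>{0..1}.
        f (\<theta> *\<^sub>R x + (1 - \<theta>) *\<^sub>R y)
          \<le> \<theta> * f x + (1 - \<theta>) * f y - \<mu> / 2 * \<theta> * (1 - \<theta>) * (norm (x - y))\<^sup>2)"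

text \<open>
  The supremum is taken in the reals, so the value is meaningful only where the conjugate is
  finite. This is the case everywhere for a real-valued strongly convex function with positive
  modulus on a Euclidean space.
\<close>

definition conjugate :: "('a::real_inner \<Rightarrow> real) \<Rightarrow> 'a \<Rightarrow> real" where
  "conjugate f s = (SUP x. s \<bullet> x - f x)"

definition dual_cone :: "'a::real_inner set \<Rightarrow> 'a set" where
  "dual_cone K = {y. \<forall>x\<in>K. 0 \<le> x \<bullet> y}"

definition regular_cone :: "'a::real_inner set \<Rightarrow> bool" where
  "regular_cone K \<longleftrightarrow>
     closed K \<and> convex_cone K \<and> K \<inter> uminus ` K = {0} \<and> interior K \<noteq> {}"

definition dual_objective ::
    "('a::euclidean_space \<Rightarrow> real) \<Rightarrow> ('a \<Rightarrow> 'b::euclidean_space) \<Rightarrow> 'b \<Rightarrow> 'b \<Rightarrow> real" where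
  "dual_objective f T b y = (conjugate f \<circ> adjoint T) y + b \<bullet> y"

end

theory Submission
  imports Defs
begin

text \<open>
  Strong convexity makes the supremum defining the conjugate at \<open>s\<close> attained at a point \<open>p\<close>, which
  is the only possible gradient there, and yields quadratic growth of \<open>f - \<langle>s, \<cdot>\<rangle>\<close> away from \<open>p\<close>
  and a quadratic upper bound on the conjugate around \<open>s\<close>. The upper bound turns optimality of
  \<open>y_opt\<close> into the KKT conditions: for the maximiser \<open>p\<close> at \<open>T\<^sup>* y_opt\<close>, the vector \<open>T p + b\<close> lies in
  the bidual cone of \<open>K\<close>, which is \<open>K\<close>, and is orthogonal to \<open>y_opt\<close>. Quadratic growth then shows
  that \<open>p\<close> is the unique primal solution and that
  \<open>\<mu> / 2 * \<parallel>x\<^sub>k - p\<parallel>\<^sup>2 \<le> h y\<^sub>k - d\<close>.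
\<close>

section \<open>Strong convexity and conjugates\<close>

lemma strongly_convexD:
  assumes "strongly_convex \<mu> f" "0 \<le> t" "t \<le> 1"
  shows "f (t *\<^sub>R x + (1 - t) *\<^sub>R y)
    \<le> t * f x + (1 - t) * f y - \<mu> / 2 * t * (1 - t) * (norm (x - y))\<^sup>2"
  using assms by (simp add: strongly_convex_def)

lemma strongly_convex_diff_inner:
  assumes "strongly_convex \<mu> f"
  shows "strongly_convex \<mu> (\<lambda>x. f x - s \<bullet> x)"
  unfolding strongly_convex_def
proof (intro allI ballI)
  fix x y and t :: real
  assume "t \<in> {0..1}"
  then show "f (t *\<^sub>R x + (1 - t) *\<^sub>R y) - s \<bullet> (t *\<^sub>R x + (1 - t) *\<^sub>R y)
    \<le> t * (f x - s \<bullet> x) + (1 - t) * (f y - s \<bullet> y) - \<mu> / 2 * t * (1 - t) * (norm (x - y))\<^sup>2"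
    using strongly_convexD[OF assms, of t x y] by (simp add: inner_right_distrib right_diff_distrib)
qed

lemma strongly_convex_imp_convex_on:
  fixes f :: "'a::real_inner \<Rightarrow> real"
  assumes "strongly_convex \<mu> f" "0 \<le> \<mu>"
  shows "convex_on UNIV f"
proof (rule convex_onI)
  fix t :: real and x y :: 'a
  assume t: "0 < t" "t < 1"
  have "0 \<le> \<mu> / 2 * t * (1 - t) * (norm (y - x))\<^sup>2"
    using t assms(2) by simp
  then show "f ((1 - t) *\<^sub>R x + t *\<^sub>R y) \<le> (1 - t) * f x + t * f y"
    using strongly_convexD[OF assms(1), of t y x] t by (simp add: add.commute)
qed simp

text \<open>The quadratic term forces \<open>g 0 \<le> g z\<close> once \<open>z\<close> leaves a
  large ball, so a minimum over that ball is global. Continuity, needed for minima over balls, comes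
  from convexity on the whole space.\<close>

lemma strongly_convex_attains_min:
  fixes g :: "'a::euclidean_space \<Rightarrow> real"
  assumes g: "strongly_convex \<mu> g" and \<mu>: "0 < \<mu>"
  obtains p where "\<And>z. g p \<le> g z"
proof -
  have cont: "continuous_on S g" for S
    using convex_on_continuous[of UNIV g] strongly_convex_imp_convex_on[OF g] \<mu>
      continuous_on_subset by force
  obtain q where q: "\<And>z. z \<in> cball 0 1 \<Longrightarrow> g q \<le> g z"
    using continuous_attains_inf[OF compact_cball _ cont, of 0 1] by (metis cball_eq_empty not_one_less_zero)
  \<comment> \<open>The radius solves \<open>\<mu> / 2 * (R - 1) = g 0 - g q\<close>; as
    \<open>0\<close> lies in the unit ball, the right side is nonnegative.\<close>
  define R where "R = 1 + 2 * (g 0 - g q) / \<mu>"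
  have R: "1 \<le> R"
    using q[of 0] \<mu> by (simp add: R_def)
  have far: "g 0 \<le> g z" if "R < norm z" for z
  proof -
    define r where "r = norm z"
    have r: "1 < r" "R < r" "1 / r \<le> 1"
      using that R by (simp_all add: r_def divide_le_eq_1)
    \<comment> \<open>The point \<open>z / r\<close> of the unit sphere is a convex combination of
      \<open>z\<close> and \<open>0\<close>; its value is bounded below by the minimum
      \<open>g q\<close> and above by strong convexity.\<close>
    have "g q \<le> g ((1 / r) *\<^sub>R z + (1 - 1 / r) *\<^sub>R 0)"
      using q[of "(1 / r) *\<^sub>R z"] r by (simp add: r_def)
    also have "\<dots> \<le> 1 / r * g z + (1 - 1 / r) * g 0 - \<mu> / 2 * (1 / r) * (1 - 1 / r) * r\<^sup>2"
      using strongly_convexD[OF g, of "1 / r" z 0] r by (simp add: r_def)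
    finally have "r * g q \<le> r * (1 / r * g z + (1 - 1 / r) * g 0 - \<mu> / 2 * (1 / r) * (1 - 1 / r) * r\<^sup>2)"
      using r by simp
    also have "\<dots> = g z - g 0 + r * (g 0 - \<mu> / 2 * (r - 1))"
      using r by (simp add: field_simps power2_eq_square)
    finally have "r * (\<mu> / 2 * (r - 1) - (g 0 - g q)) \<le> g z - g 0"
      by (simp add: algebra_simps)
    moreover have "0 \<le> r * (\<mu> / 2 * (r - 1) - (g 0 - g q))"
      using r \<mu> by (intro mult_nonneg_nonneg) (simp_all add: R_def field_simps)
    ultimately show ?thesis by linarith
  qed
  obtain p where p: "\<And>z. z \<in> cball 0 R \<Longrightarrow> g p \<le> g z"
    using continuous_attains_inf[OF compact_cball _ cont, of 0 R] R by fastforce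
  have "g p \<le> g z" for z
    using p[of z] p[of 0] far[of z] R by (cases "norm z \<le> R") auto
  then show ?thesis using that by blast
qed

text \<open>Compare \<open>g p\<close> with the value at \<open>t z + (1 - t) p\<close>, cancel
  \<open>(1 - t) * g p\<close>, divide by \<open>t\<close> and let \<open>t\<close> tend to 0 from
  the right.\<close>

lemma strongly_convex_growth:
  assumes g: "strongly_convex \<mu> g" and p: "\<And>z. g p \<le> g z"
  shows "g p + \<mu> / 2 * (norm (z - p))\<^sup>2 \<le> g z"
proof -
  define c where "c = \<mu> / 2 * (norm (z - p))\<^sup>2"
  have le: "g p + (1 - t) * c \<le> g z" if t: "0 < t" "t < 1" for t :: real
  proof -
    have "t * (g p + (1 - t) * c) \<le> t * g z"
      using p[of "t *\<^sub>R z + (1 - t) *\<^sub>R p"] strongly_convexD[OF g, of t z p] t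
      by (simp add: c_def algebra_simps)
    then show ?thesis using t by simp
  qed
  have "((\<lambda>t. g p + (1 - t) * c) \<longlongrightarrow> g p + (1 - 0) * c) (at_right (0::real))"
    by (intro tendsto_intros)
  moreover have "\<forall>\<^sub>F t in at_right (0::real). g p + (1 - t) * c \<le> g z"
    using le by (auto simp: eventually_at_right[of 0 1] intro!: exI[of _ 1])
  ultimately have "g p + (1 - 0) * c \<le> g z"
    by (rule tendsto_upperbound) simp
  then show ?thesis by (simp add: c_def)
qed

lemma conjugate_eq_max:
  assumes "\<And>z. f p - s \<bullet> p \<le> f z - s \<bullet> z"
  shows "conjugate f s = s \<bullet> p - f p"
  unfolding conjugate_def
  \<comment> \<open>Attainment makes the real-valued \<open>SUP\<close> a genuine maximum, so no
    default value enters.\<close>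
  by (rule cSup_eq_maximum) (use assms in \<open>force simp: algebra_simps\<close>)+

lemma strongly_convex_conjugate_attained:
  fixes f :: "'a::euclidean_space \<Rightarrow> real"
  assumes "strongly_convex \<mu> f" "0 < \<mu>"
  obtains p where "conjugate f s = s \<bullet> p - f p"
    "\<And>z. f p + s \<bullet> (z - p) + \<mu> / 2 * (norm (z - p))\<^sup>2 \<le> f z"
proof -
  note g = strongly_convex_diff_inner[OF assms(1), of s]
  obtain p where p: "\<And>z. f p - s \<bullet> p \<le> f z - s \<bullet> z"
    using strongly_convex_attains_min[OF g assms(2)] by blast
  show ?thesis
  proof
    show "conjugate f s = s \<bullet> p - f p"
      by (rule conjugate_eq_max[OF p])
    show "f p + s \<bullet> (z - p) + \<mu> / 2 * (norm (z - p))\<^sup>2 \<le> f z" for z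
      using strongly_convex_growth[OF g p, of z] by (simp add: inner_diff_right)
  qed
qed

lemma fenchel_young:
  fixes f :: "'a::euclidean_space \<Rightarrow> real"
  assumes "strongly_convex \<mu> f" "0 < \<mu>"
  shows "s \<bullet> z - f z \<le> conjugate f s"
proof -
  obtain p where p: "conjugate f s = s \<bullet> p - f p"
    "\<And>z. f p + s \<bullet> (z - p) + \<mu> / 2 * (norm (z - p))\<^sup>2 \<le> f z"
    using strongly_convex_conjugate_attained[OF assms] by metis
  have "0 \<le> \<mu> / 2 * (norm (z - p))\<^sup>2"
    using assms(2) by simp
  then show ?thesis
    using p(1) p(2)[of z] by (simp add: inner_diff_right)
qed

text \<open>Subtracting the linear term \<open>s' \<bullet> p\<close> leaves a function minimal at
  \<open>s\<close>, where its derivative must vanish; testing it on \<open>x - p\<close> gives the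
  equality.\<close>

lemma gderiv_touching_affine:
  fixes F :: "'a::real_inner \<Rightarrow> real"
  assumes "GDERIV F s :> x" and lower: "\<And>s'. F s + (s' - s) \<bullet> p \<le> F s'"
  shows "x = p"
proof -
  have "((\<lambda>s'. F s' - s' \<bullet> p) has_derivative (\<lambda>h. h \<bullet> x - h \<bullet> p)) (at s)"
    using assms(1) unfolding gderiv_def by (auto intro!: derivative_eq_intros)
  then have "(\<lambda>h. h \<bullet> x - h \<bullet> p) = (\<lambda>h. 0)"
    by (rule has_derivative_local_min)
      (use lower in \<open>auto simp: inner_diff_left algebra_simps intro!: always_eventually\<close>)
  then have "(x - p) \<bullet> x - (x - p) \<bullet> p = 0"
    by meson
  then show ?thesis
    by (simp flip: inner_diff_right)
qed

lemma strongly_convex_gderiv_conjugate: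
  fixes f :: "'a::euclidean_space \<Rightarrow> real"
  assumes f: "strongly_convex \<mu> f" "0 < \<mu>" and x: "GDERIV (conjugate f) s :> x"
  shows "conjugate f s = s \<bullet> x - f x"
    and "f x + s \<bullet> (z - x) + \<mu> / 2 * (norm (z - x))\<^sup>2 \<le> f z"
proof -
  obtain p where p: "conjugate f s = s \<bullet> p - f p"
    "\<And>z. f p + s \<bullet> (z - p) + \<mu> / 2 * (norm (z - p))\<^sup>2 \<le> f z"
    using strongly_convex_conjugate_attained[OF f] by metis
  \<comment> \<open>The maximiser at \<open>s\<close> is a competitor at every \<open>s'\<close>, so
    it is the slope of an affine minorant touching the conjugate at \<open>s\<close>.\<close>
  have "conjugate f s + (s' - s) \<bullet> p \<le> conjugate f s'" for s'
    using fenchel_young[OF f, of s' p] p(1) by (simp add: inner_diff_left)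
  then have "x = p"
    using gderiv_touching_affine[OF x] by blast
  then show "conjugate f s = s \<bullet> x - f x"
    "f x + s \<bullet> (z - x) + \<mu> / 2 * (norm (z - x))\<^sup>2 \<le> f z"
    using p by auto
qed

text \<open>Strong convexity of \<open>f\<close> dualises to smoothness of the conjugate. Growth
  around \<open>p\<close> absorbs the perturbation \<open>v \<bullet> (z - p)\<close> by
  Cauchy-Schwarz and the weighted Young inequality, uniformly in \<open>z\<close>.\<close>

lemma conjugate_quadratic_upper_bound:
  fixes f :: "'a::euclidean_space \<Rightarrow> real"
  assumes f: "strongly_convex \<mu> f" and \<mu>: "0 < \<mu>" and p: "conjugate f s = s \<bullet> p - f p"
    "\<And>z. f p + s \<bullet> (z - p) + \<mu> / 2 * (norm (z - p))\<^sup>2 \<le> f z"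
  shows "conjugate f (s + v) \<le> conjugate f s + v \<bullet> p + (norm v)\<^sup>2 / (2 * \<mu>)"
proof -
  have "(s + v) \<bullet> z - f z \<le> conjugate f s + v \<bullet> p + (norm v)\<^sup>2 / (2 * \<mu>)" for z
  proof -
    have "v \<bullet> (z - p) \<le> norm v * norm (z - p)"
      by (rule norm_cauchy_schwarz)
    also have "\<dots> \<le> \<mu> / 2 * (norm (z - p))\<^sup>2 + (norm v)\<^sup>2 / (2 * \<mu>)"
    proof -
      have "0 \<le> (norm v - \<mu> * norm (z - p))\<^sup>2 / (2 * \<mu>)"
        using \<mu> by simp
      then show ?thesis
        using \<mu> by (simp add: power2_eq_square field_simps)
    qed
    finally show ?thesis
      using p(1) p(2)[of z] by (simp add: inner_add_left inner_diff_right)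
  qed
  then show ?thesis
    unfolding conjugate_def[of f "s + v"] by (intro cSUP_least) auto
qed

section \<open>Optimality conditions\<close>

lemma linear_term_nonneg:
  fixes a c :: real
  assumes "\<And>t. 0 < t \<Longrightarrow> t \<le> 1 \<Longrightarrow> 0 \<le> t * a + t\<^sup>2 * c"
  shows "0 \<le> a"
proof -
  have "((\<lambda>t. a + t * c) \<longlongrightarrow> a + 0 * c) (at_right (0::real))"
    by (intro tendsto_intros)
  moreover have "\<forall>\<^sub>F t in at_right (0::real). 0 \<le> a + t * c"
  proof -
    have "0 \<le> a + t * c" if "0 < t" "t < 1" for t :: real
    proof -
      have "0 \<le> t * (a + t * c)"
        using assms[of t] that by (simp add: power2_eq_square algebra_simps)
      then show ?thesis
        using that by (simp add: zero_le_mult_iff)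
    qed
    then show ?thesis
      by (auto simp: eventually_at_right[of 0 1] intro!: exI[of _ 1])
  qed
  ultimately have "0 \<le> a + 0 * c"
    by (rule tendsto_lowerbound) simp
  then show ?thesis by simp
qed

text \<open>The nontrivial half of the bidual cone theorem, by separating a point outside
  \<open>K\<close> from \<open>K\<close>.\<close>

lemma mem_convex_cone_if_dual_nonneg:
  fixes K :: "'a::euclidean_space set"
  assumes K: "closed K" "convex_cone K" and z: "\<And>y. y \<in> dual_cone K \<Longrightarrow> 0 \<le> z \<bullet> y"
  shows "z \<in> K"
proof (rule ccontr)
  assume "z \<notin> K"
  moreover have K': "convex K" "0 \<in> K" "\<And>x c. x \<in> K \<Longrightarrow> 0 \<le> c \<Longrightarrow> c *\<^sub>R x \<in> K"
    using K(2) convex_cone_contains_0 by (auto simp: convex_cone_def conic_def)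
  ultimately obtain a c where ac: "a \<bullet> z < c" "\<And>x. x \<in> K \<Longrightarrow> c < a \<bullet> x"
    using separating_hyperplane_closed_point[of K z] K(1) by blast
  have "c < 0"
    using ac(2)[OF K'(2)] by simp
  have "0 \<le> a \<bullet> x" if "x \<in> K" for x
  proof (rule ccontr)
    assume "\<not> 0 \<le> a \<bullet> x"
    then show False
      \<comment> \<open>Both \<open>c\<close> and \<open>a \<bullet> x\<close> are negative, so this
        rescaling of \<open>x\<close> stays in \<open>K\<close> and has inner product exactly
        \<open>c\<close> with \<open>a\<close>, against strict separation.\<close>
      using ac(2)[OF K'(3)[OF that, of "c / (a \<bullet> x)"]] \<open>c < 0\<close>
      by (simp add: divide_nonpos_neg)
  qed
  then have "a \<in> dual_cone K"
    by (auto simp: dual_cone_def inner_commute)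
  then show False
    using z ac(1) \<open>c < 0\<close> by (fastforce simp: inner_commute)
qed

lemma dual_minimizer_kkt:
  fixes f :: "'a::euclidean_space \<Rightarrow> real" and T :: "'a \<Rightarrow> 'b::euclidean_space"
  assumes f: "strongly_convex \<mu> f" "0 < \<mu>" and T: "linear T"
    and K: "closed K" "convex_cone K"
    and opt: "is_arg_min (dual_objective f T b) (\<lambda>z. z \<in> dual_cone K) w"
    and p: "conjugate f (adjoint T w) = adjoint T w \<bullet> p - f p"
      "\<And>z. f p + adjoint T w \<bullet> (z - p) + \<mu> / 2 * (norm (z - p))\<^sup>2 \<le> f z"
  shows "T p + b \<in> K" "(T p + b) \<bullet> w = 0"
proof -
  have w: "w \<in> dual_cone K"
    and min: "\<And>z. z \<in> dual_cone K \<Longrightarrow> dual_objective f T b w \<le> dual_objective f T b z"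
    using opt by (auto simp: is_arg_min_linorder)
  have lin: "linear (adjoint T)"
    by (rule adjoint_linear[OF T])
  \<comment> \<open>First-order condition along a feasible direction: the quadratic upper bound
    limits the change of the dual objective to \<open>t * ((T p + b) \<bullet> v)\<close> plus a
    term of order \<open>t\<^sup>2\<close>.\<close>
  have dir: "0 \<le> (T p + b) \<bullet> v"
    if v: "\<And>t. 0 < t \<Longrightarrow> t \<le> 1 \<Longrightarrow> w + t *\<^sub>R v \<in> dual_cone K" for v
  proof (rule linear_term_nonneg)
    fix t :: real
    assume t: "0 < t" "t \<le> 1"
    have "conjugate f (adjoint T w + t *\<^sub>R adjoint T v)
      \<le> conjugate f (adjoint T w) + t * (adjoint T v \<bullet> p) + t\<^sup>2 * ((norm (adjoint T v))\<^sup>2 / (2 * \<mu>))"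
      using conjugate_quadratic_upper_bound[OF f p, of "t *\<^sub>R adjoint T v"]
      by (simp add: power_mult_distrib)
    moreover have "dual_objective f T b w \<le> dual_objective f T b (w + t *\<^sub>R v)"
      using min v t by blast
    ultimately show "0 \<le> t * ((T p + b) \<bullet> v) + t\<^sup>2 * ((norm (adjoint T v))\<^sup>2 / (2 * \<mu>))"
      by (simp add: dual_objective_def linear_add[OF lin] linear_scale[OF lin] inner_add_left
          inner_add_right adjoint_clauses[OF T] inner_commute algebra_simps)
  qed
  show "T p + b \<in> K"
  proof (rule mem_convex_cone_if_dual_nonneg[OF K])
    fix v assume "v \<in> dual_cone K"
    then show "0 \<le> (T p + b) \<bullet> v"
      using w by (intro dir) (auto simp: dual_cone_def inner_add_right)
  qed
  then have "0 \<le> (T p + b) \<bullet> w"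
    using w by (auto simp: dual_cone_def)
  \<comment> \<open>Moving along \<open>- w\<close> stays on the ray of \<open>w\<close> as long as
    \<open>t \<le> 1\<close>; together with the direction into \<open>K\<close> this gives
    complementary slackness.\<close>
  moreover have "0 \<le> (T p + b) \<bullet> (- w)"
  proof (rule dir)
    fix t :: real
    assume "0 < t" "t \<le> 1"
    then show "w + t *\<^sub>R (- w) \<in> dual_cone K"
      using w by (auto simp: dual_cone_def inner_diff_right mult_left_le_one_le)
  qed
  ultimately show "(T p + b) \<bullet> w = 0"
    by simp
qed

theorem theorem4p7:
  fixes f :: "'a::euclidean_space \<Rightarrow> real"
    and T :: "'a \<Rightarrow> 'b::euclidean_space"
    and b e :: 'b
    and K :: "'b set"
    and \<mu> c\<^sub>D d :: real
    and x :: "nat \<Rightarrow> 'a"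
    and y :: "nat \<Rightarrow> 'b"
  assumes "\<mu> > 0"
    and "closed (epigraph UNIV f)"
    and "strongly_convex \<mu> f"
    and "linear T"
    and "regular_cone K"
    and "e \<in> interior K"
    and "c\<^sub>D > 0"
    and "\<exists>y_opt. is_arg_min (dual_objective f T b) (\<lambda>z. z \<in> dual_cone K) y_opt \<and> e \<bullet> y_opt \<le> c\<^sub>D"
    and "d = (INF z\<in>dual_cone K. dual_objective f T b z)"
    and "\<And>k. y k \<in> dual_cone K"
    and "\<And>k. e \<bullet> y k \<le> c\<^sub>D"
    and "\<And>k. GDERIV (conjugate f) (adjoint T (y k)) :> x k"
    and "(\<lambda>k. dual_objective f T b (y k)) \<longlonglongrightarrow> d"
  shows "(\<exists>!x_opt. is_arg_min f (\<lambda>z. T z + b \<in> K) x_opt) \<and>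
         x \<longlonglongrightarrow> (THE x_opt. is_arg_min f (\<lambda>z. T z + b \<in> K) x_opt)"
proof -
  note f = \<open>strongly_convex \<mu> f\<close> \<open>\<mu> > 0\<close>
  have K: "closed K" "convex_cone K"
    using \<open>regular_cone K\<close> by (auto simp: regular_cone_def)
  obtain w where w: "is_arg_min (dual_objective f T b) (\<lambda>z. z \<in> dual_cone K) w"
    using assms(8) by blast
  obtain p where p: "conjugate f (adjoint T w) = adjoint T w \<bullet> p - f p"
    "\<And>z. f p + adjoint T w \<bullet> (z - p) + \<mu> / 2 * (norm (z - p))\<^sup>2 \<le> f z"
    using strongly_convex_conjugate_attained[OF f] by metis
  note kkt = dual_minimizer_kkt[OF f \<open>linear T\<close> K w p]
  have "w \<in> dual_cone K"
    using w by (simp add: is_arg_min_def)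
  \<comment> \<open>By complementary slackness, \<open>adjoint T w \<bullet> (z - p)\<close> equals
    \<open>(T z + b) \<bullet> w\<close>, which is nonnegative for feasible
    \<open>z\<close>.\<close>
  have growth: "f p + \<mu> / 2 * (norm (z - p))\<^sup>2 \<le> f z" if "T z + b \<in> K" for z
  proof -
    have "0 \<le> (T z + b) \<bullet> w"
      using that \<open>w \<in> dual_cone K\<close> by (auto simp: dual_cone_def)
    then have "0 \<le> adjoint T w \<bullet> (z - p)"
      using kkt(2) \<open>linear T\<close>
      by (simp add: adjoint_clauses linear_diff inner_diff_right inner_add_right inner_commute)
    then show ?thesis
      using p(2)[of z] by linarith
  qed
  have p_min: "is_arg_min f (\<lambda>z. T z + b \<in> K) p"
    unfolding is_arg_min_linorder
  proof (intro conjI allI impI)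
    fix z assume "T z + b \<in> K"
    moreover have "0 \<le> \<mu> / 2 * (norm (z - p))\<^sup>2"
      using \<open>\<mu> > 0\<close> by simp
    ultimately show "f p \<le> f z"
      using growth[of z] by linarith
  qed (rule kkt(1))
  have p_unique: "z = p" if "is_arg_min f (\<lambda>z. T z + b \<in> K) z" for z
  proof -
    have "f z \<le> f p" "T z + b \<in> K"
      using that kkt(1) by (auto simp: is_arg_min_linorder)
    then have "\<mu> / 2 * (norm (z - p))\<^sup>2 \<le> 0"
      using growth[of z] by linarith
    then show ?thesis
      using \<open>\<mu> > 0\<close> by (simp add: mult_le_0_iff)
  qed
  \<comment> \<open>The dual value is \<open>(T p + b) \<bullet> w - f p\<close>, so complementary
    slackness closes the duality gap up to the sign convention.\<close>
  have "dual_objective f T b w = - f p"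
    using p(1) kkt(2) \<open>linear T\<close>
    by (simp add: dual_objective_def adjoint_clauses inner_add_right inner_commute)
  moreover have "d = dual_objective f T b w"
    unfolding assms(9) using w by (intro cInf_eq_minimum) (auto simp: is_arg_min_linorder)
  ultimately have d: "d = - f p" by simp
  \<comment> \<open>Since \<open>x k\<close> attains the conjugate at
    \<open>adjoint T (y k)\<close>, growth around \<open>x k\<close> evaluated at \<open>p\<close>
    bounds the gap below by \<open>(T p + b) \<bullet> y k\<close> plus the quadratic term; the
    former is nonnegative because \<open>p\<close> is feasible.\<close>
  have gap: "\<mu> / 2 * (norm (x k - p))\<^sup>2 \<le> dual_objective f T b (y k) - d" for k
  proof -
    have "0 \<le> (T p + b) \<bullet> y k"
      using assms(10)[of k] kkt(1) by (auto simp: dual_cone_def)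
    then show ?thesis
      using strongly_convex_gderiv_conjugate(1)[OF f assms(12), of k]
        strongly_convex_gderiv_conjugate(2)[OF f assms(12), of k p] \<open>linear T\<close>
      by (simp add: d dual_objective_def adjoint_clauses linear_diff inner_add_right inner_diff_right
          inner_commute norm_minus_commute)
  qed
  have "(\<lambda>k. (norm (x k - p))\<^sup>2) \<longlonglongrightarrow> 0"
  proof (rule tendsto_sandwich[where f = "\<lambda>_. 0"])
    show "\<forall>\<^sub>F k in sequentially. (norm (x k - p))\<^sup>2 \<le> 2 / \<mu> * (dual_objective f T b (y k) - d)"
      using gap \<open>\<mu> > 0\<close> by (simp add: field_simps)
    show "(\<lambda>k. 2 / \<mu> * (dual_objective f T b (y k) - d)) \<longlonglongrightarrow> 0"
      using tendsto_mult[OF tendsto_const tendsto_diff[OF assms(13) tendsto_const], of "2 / \<mu>" d]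
      by simp
  qed simp_all
  then have "(\<lambda>k. norm (x k - p)) \<longlonglongrightarrow> 0"
    using tendsto_real_sqrt[of "\<lambda>k. (norm (x k - p))\<^sup>2" 0] by simp
  then have "x \<longlonglongrightarrow> p"
    by (simp add: tendsto_norm_zero_iff LIM_zero_iff)
  moreover have "(THE x_opt. is_arg_min f (\<lambda>z. T z + b \<in> K) x_opt) = p"
    using p_min p_unique by (rule the_equality)
  moreover have "\<exists>!x_opt. is_arg_min f (\<lambda>z. T z + b \<in> K) x_opt"
    using p_min p_unique by (rule ex1I)
  ultimately show ?thesis
    by simp
qed

end
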